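(* Let $G$ be a graph with $n$ vertices and $m$ edges that has two edge-disjoint spanning trees. Then: (a) $G$ has at least $2^{n/250}$ nowhere-zero $\mathbb{Z}_2\times \mathbb{Z}_2$-flows; (b) $G$ has at least $3^{m-2n+2}$ nowhere-zero $\mathbb{Z}_2\times \mathbb{Z}_2$-flows.
   Context: Graphs are finite and may have loops and parallel edges. For an abelian group $\Gamma$ in which every element has order at most $2$ (such as $\mathbb{Z}_2\times\mathbb{Z}_2$), a $\Gamma$-flow on $G$ is a map $\phi:E(G)\to\Gamma$ such that for every vertex $v$ the sum of $\phi(e)$ over the edges $e$ incident with $v$ (loops counted twice) is $0$; no orientation is needed. It is nowhere-zero if $\phi(e)\ne 0$ for every edge $e$.
   Formalization: Part (a) excludes the graph with one vertex and no edges (n = 1, m = 0), where the claim fails: its two empty spanning trees are edge-disjoint, but it has exactly one nowhere-zero flow, fewer than 2^{1/250}. *)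

theory Defs
  imports
    Complex_Main
    "HOL-Library.FuncSet"
    "HOL-Library.Product_Plus"
    "HOL-Library.Uprod"
    "HOL-Library.Z2"
begin

(* Undirected graphs with loops and parallel edges: edges are abstract objects, and the
   two ends of an edge form an unordered pair; Upair v v are the ends of a loop at v. *)
record ('v, 'e) multigraph =
  mverts :: "'v set"
  medges :: "'e set"
  mends :: "'e \<Rightarrow> 'v uprod"

locale finite_multigraph =
  fixes G :: "('v, 'e) multigraph"
  assumes finite_mverts: "finite (mverts G)"
    and finite_medges: "finite (medges G)"
    and mends_in_mverts: "\<And>e. e \<in> medges G \<Longrightarrow> set_uprod (mends G e) \<subseteq> mverts G"

definition madj :: "('v, 'e) multigraph \<Rightarrow> ('v \<times> 'v) set" where
  "madj G = {(u, v). \<exists>e \<in> medges G. mends G e = Upair u v}"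

(* The null graph is not connected, hence not a tree. *)
definition mconnected :: "('v, 'e) multigraph \<Rightarrow> bool" where
  "mconnected G \<longleftrightarrow>
     mverts G \<noteq> {} \<and> (\<forall>u \<in> mverts G. \<forall>v \<in> mverts G. (u, v) \<in> (madj G)\<^sup>*)"

(* The edge es ! i joins vs ! i to its cyclic successor. A loop is a cycle of length 1,
   and two parallel edges form a cycle of length 2; distinctness of es prevents a single
   edge, traversed back and forth, from counting as a cycle. *)
definition mcycle :: "('v, 'e) multigraph \<Rightarrow> 'v list \<Rightarrow> 'e list \<Rightarrow> bool" where
  "mcycle G vs es \<longleftrightarrow>
     es \<noteq> [] \<and> length vs = length es \<and> distinct vs \<and> distinct es \<and>
     set vs \<subseteq> mverts G \<and> set es \<subseteq> medges G \<and>
     (\<forall>i < length es. mends G (es ! i) = Upair (vs ! i) (vs ! (Suc i mod length es)))"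

definition mtree :: "('v, 'e) multigraph \<Rightarrow> bool" where
  "mtree G \<longleftrightarrow> mconnected G \<and> (\<nexists>vs es. mcycle G vs es)"

(* A spanning tree is given by its edge set T; its vertex set is that of G. If G is a
   single vertex without edges, the empty set is a spanning tree, edge-disjoint from itself,
   and G has exactly one nowhere-zero flow. *)
definition mspanning_tree :: "('v, 'e) multigraph \<Rightarrow> 'e set \<Rightarrow> bool" where
  "mspanning_tree G T \<longleftrightarrow> T \<subseteq> medges G \<and> mtree (G\<lparr>medges := T\<rparr>)"

(* Meant for groups in which x + x = 0 for every x, such as bit * bit, so that no
   orientation is needed. Flows are extensional: they take the value undefined outside
   the edge set, so that each map on the edge set is counted exactly once. *)
definition mflows :: "('v, 'e) multigraph \<Rightarrow> ('e \<Rightarrow> 'g::ab_group_add) set" where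
  "mflows G = {\<phi> \<in> medges G \<rightarrow>\<^sub>E UNIV.
     \<forall>v \<in> mverts G.
       (\<Sum>e \<in> {e \<in> medges G. v \<in> set_uprod (mends G e)}.
          if mends G e = Upair v v then \<phi> e + \<phi> e else \<phi> e) = 0}"

definition nowhere_zero_mflows :: "('v, 'e) multigraph \<Rightarrow> ('e \<Rightarrow> 'g::ab_group_add) set" where
  "nowhere_zero_mflows G = {\<phi> \<in> mflows G. \<forall>e \<in> medges G. \<phi> e \<noteq> 0}"

end

theory Submission
  imports Defs
begin

text \<open>A \<open>\<int>\<^sub>2 \<times> \<int>\<^sub>2\<close>-flow is a pair of \<open>\<int>\<^sub>2\<close>-flows, and a \<open>\<int>\<^sub>2\<close>-flow can be
  prescribed arbitrarily outside a connected spanning edge set. Let \<open>T1\<close>, \<open>T2\<close> be disjoint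
  spanning trees. For (b), prescribe nonzero values outside \<open>T1 \<union> T2\<close>, first component 1 on
  \<open>T2\<close> and second component 1 on \<open>T1\<close>.

  For (a), by multiple symmetric exchange there are at least \<open>2^(n-1)\<close> ways to split
  \<open>T1 \<union> T2\<close> into two spanning trees \<open>S\<close>, \<open>S'\<close>. For each of them choose a first component \<open>A\<close>
  that is 1 outside \<open>S'\<close>. The second component has to be 1 only on the edges of \<open>S'\<close> where
  \<open>A\<close> vanishes, so if \<open>A\<close> is 1 on \<open>j\<close> edges of \<open>S'\<close>, there are at least \<open>2^j\<close> flows. If \<open>j\<close> is
  always less than \<open>n/250\<close>, then \<open>S\<close> is almost the whole support of \<open>A\<close> in \<open>T1 \<union> T2\<close>, so \<open>A\<close>
  comes from few \<open>S\<close> and there are exponentially many choices of \<open>A\<close>.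

  The exchange property follows from a parity argument: a set of \<open>n-1\<close> edges whose incidence
  matrix without the row of a root has odd permanent is connected.\<close>

section \<open>Incidence modulo 2, cancellation in pairs and a binomial bound\<close>

text \<open>A loop meets its vertex twice, so its entry in the incidence matrix modulo 2 is
  0.\<close>

definition inc :: "('v, 'e) multigraph \<Rightarrow> 'e \<Rightarrow> 'v \<Rightarrow> bit" where
  "inc G e v = (if mends G e = Upair v v then 0 else of_bool (v \<in> set_uprod (mends G e)))"

lemma inc_Upair:
  assumes "mends G e = Upair a b"
  shows "inc G e v = of_bool (v = a) + of_bool (v = b)"
  using assms by (auto simp: inc_def)

lemma inc_nonzeroD: "inc G e v \<noteq> 0 \<Longrightarrow> v \<in> set_uprod (mends G e)"
  by (auto simp: inc_def split: if_splits)

abbreviation mconnecting :: "('v, 'e) multigraph \<Rightarrow> 'e set \<Rightarrow> bool" where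
  "mconnecting G S \<equiv> mconnected (G\<lparr>medges := S\<rparr>)"

lemma bit_add_eq_0_iff: "a + b = 0 \<longleftrightarrow> a = b" for a b :: bit
  by (cases a; cases b) simp_all

text \<open>The terms at \<open>x\<close> and \<open>i x\<close> are equal and cancel in
  characteristic 2; what remains is a smaller set closed under \<open>i\<close>.\<close>

lemma sum_bit_involution:
  fixes f :: "'a \<Rightarrow> bit"
  assumes "finite A"
    and "\<And>x. x \<in> A \<Longrightarrow> i x \<in> A" "\<And>x. x \<in> A \<Longrightarrow> i (i x) = x"
    and "\<And>x. x \<in> A \<Longrightarrow> i x \<noteq> x" "\<And>x. x \<in> A \<Longrightarrow> f (i x) = f x"
  shows "sum f A = 0"
  using assms
proof (induction A rule: finite_psubset_induct)
  case (psubset A)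
  show ?case
  proof (cases "A = {}")
    case False
    then obtain x where x: "x \<in> A" by blast
    let ?B = "A - {x, i x}"
    have "sum f ?B = 0"
    proof (rule psubset.IH)
      show "?B \<subset> A" using x by blast
      show "i y \<in> ?B" if "y \<in> ?B" for y
        using that psubset.prems(1,2) x by (metis Diff_iff insert_iff empty_iff)
    qed (use psubset.prems in auto)
    moreover have "A = insert x (insert (i x) ?B)"
      using x psubset.prems(1) by blast
    moreover have "sum f (insert x (insert (i x) ?B)) = f x + (f (i x) + sum f ?B)"
      using psubset.hyps psubset.prems(3)[OF x] by (subst sum.insert) auto
    ultimately show ?thesis using psubset.prems(4)[OF x] by simp
  qed simp
qed

text \<open>Divided by \<open>2 ^ j\<close>, the left side is one term of the expansion of
  \<open>(1 / 2 + 1) ^ (M + j)\<close>. The bound limits how many trees fit into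
  \<open>M + j\<close> edges.\<close>

lemma binomial_le_3_power: "real ((M + j) choose j) \<le> 3 ^ j * (3 / 2) ^ M"
proof -
  have "real ((M + j) choose j) * (1 / 2) ^ j * 1 ^ (M + j - j) \<le>
      (\<Sum>k\<le>M + j. real ((M + j) choose k) * (1 / 2) ^ k * 1 ^ (M + j - k))"
    by (rule member_le_sum) auto
  also have "\<dots> = (1 / 2 + 1) ^ (M + j)" by (rule binomial_ring[symmetric])
  finally have "real ((M + j) choose j) / 2 ^ j \<le> (3 / 2) ^ (M + j)" by (simp add: power_one_over)
  then have "real ((M + j) choose j) \<le> (3 / 2) ^ (M + j) * 2 ^ j" by (simp add: pos_divide_le_eq)
  also have "\<dots> = 3 ^ j * (3 / 2) ^ M" by (simp add: power_add power_divide)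
  finally show ?thesis .
qed

section \<open>Permanents over GF(2) and symmetric exchange\<close>

definition bijs :: "'a set \<Rightarrow> 'b set \<Rightarrow> ('a \<Rightarrow> 'b) set" where
  "bijs W S = {t \<in> W \<rightarrow>\<^sub>E S. bij_betw t W S}"

lemma bijsI: "t \<in> extensional W \<Longrightarrow> bij_betw t W S \<Longrightarrow> t \<in> bijs W S"
  by (auto simp: bijs_def PiE_def bij_betw_def)

lemma finite_bijs: "finite W \<Longrightarrow> finite S \<Longrightarrow> finite (bijs W S)"
  unfolding bijs_def by (rule finite_subset[OF _ finite_PiE[of W "\<lambda>_. S"]]) auto

text \<open>Over GF(2) signs disappear, so for finite \<open>W\<close> and \<open>S\<close> of equal
  size this is the determinant of the incidence matrix with rows \<open>W\<close> and columns
  \<open>S\<close>; for different finite sizes it is 0.\<close>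

definition mpermanent :: "('v, 'e) multigraph \<Rightarrow> 'v set \<Rightarrow> 'e set \<Rightarrow> bit" where
  "mpermanent G W S = (\<Sum>t\<in>bijs W S. \<Prod>v\<in>W. inc G (t v) v)"

lemma mpermanent_nonzero_card: "mpermanent G W S \<noteq> 0 \<Longrightarrow> card S = card W"
  unfolding mpermanent_def bijs_def using bij_betw_same_card by (metis (mono_tags, lifting) mem_Collect_eq sum.not_neutral_contains_not_neutral)

lemma swap_bijs:
  assumes "t \<in> bijs W S" "x \<in> W" "y \<in> W"
  shows "t(x := t y, y := t x) \<in> bijs W S"
proof (rule bijsI)
  show "t(x := t y, y := t x) \<in> extensional W"
    using assms by (auto simp: bijs_def PiE_def extensional_def)
  let ?c = "\<lambda>c. if c = x then y else if c = y then x else c"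
  have "bij_betw (t \<circ> ?c) W S"
  proof (rule bij_betw_trans)
    show "bij_betw t W S" using assms by (simp add: bijs_def)
    show "bij_betw ?c W W"
      by (rule bij_betw_byWitness[where f' = ?c]) (use assms in auto)
  qed
  moreover have "t(x := t y, y := t x) = t \<circ> ?c"
    by auto
  ultimately show "bij_betw (t(x := t y, y := t x)) W S" by simp
qed

text \<open>On the columns \<open>S\<close> the row of \<open>u\<close> is the sum of the other rows
  in \<open>C\<close>. Multilinearity yields a sum of permanents with two equal rows each, and
  exchanging the values at these rows cancels their terms in pairs.\<close>

lemma mpermanent_disconnected:
  assumes fin: "finite W" "finite S" and C: "C \<subseteq> W" "C \<noteq> {}"
    and closed: "\<And>e. e \<in> S \<Longrightarrow> (\<Sum>w\<in>C. inc G e w) = 0"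
  shows "mpermanent G W S = 0"
proof -
  obtain u where u: "u \<in> C" using C by blast
  have finC: "finite C" using C fin finite_subset by blast
  have row: "inc G e u = (\<Sum>w\<in>C - {u}. inc G e w)" if "e \<in> S" for e
  proof -
    have "inc G e u + (\<Sum>w\<in>C - {u}. inc G e w) = 0"
      using closed[OF that] sum.remove[OF finC u, of "inc G e"] by simp
    then show ?thesis by (simp only: bit_add_eq_0_iff)
  qed
  \<comment> \<open>The product belonging to \<open>t\<close> after row \<open>u\<close> has been
    replaced by row \<open>w\<close>.\<close>
  define g where "g t w = inc G (t u) w * (\<Prod>v\<in>W - {u}. inc G (t v) v)" for t w
  have "mpermanent G W S = (\<Sum>t\<in>bijs W S. \<Sum>w\<in>C - {u}. g t w)"
    unfolding mpermanent_def
  proof (rule sum.cong[OF refl])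
    fix t assume "t \<in> bijs W S"
    then have "t u \<in> S" using u C by (auto simp: bijs_def)
    have "(\<Prod>v\<in>W. inc G (t v) v) = inc G (t u) u * (\<Prod>v\<in>W - {u}. inc G (t v) v)"
      by (rule prod.remove) (use u C fin in auto)
    then show "(\<Prod>v\<in>W. inc G (t v) v) = (\<Sum>w\<in>C - {u}. g t w)"
      by (simp only: g_def sum_distrib_right row[OF \<open>t u \<in> S\<close>])
  qed
  also have "\<dots> = (\<Sum>w\<in>C - {u}. \<Sum>t\<in>bijs W S. g t w)" by (rule sum.swap)
  also have "\<dots> = 0"
  proof (rule sum.neutral, rule ballI)
    fix w assume w: "w \<in> C - {u}"
    have uw: "u \<in> W" "w \<in> W" "u \<noteq> w" using w u C by auto
    have g: "g t w = inc G (t u) w * inc G (t w) w * (\<Prod>v\<in>W - {u} - {w}. inc G (t v) v)" for t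
      unfolding g_def using uw fin by (subst prod.remove[of _ w]) (auto simp: mult.assoc)
    show "(\<Sum>t\<in>bijs W S. g t w) = 0"
    proof (rule sum_bit_involution[where i = "\<lambda>t. t(u := t w, w := t u)"])
      show "finite (bijs W S)" using fin by (rule finite_bijs)
      fix t assume t: "t \<in> bijs W S"
      show "t(u := t w, w := t u) \<in> bijs W S" using t uw by (intro swap_bijs) auto
      have "t u \<noteq> t w" using t uw by (auto simp: bijs_def bij_betw_def inj_on_def)
      then show "t(u := t w, w := t u) \<noteq> t" by (metis fun_upd_apply)
      show "g (t(u := t w, w := t u)) w = g t w"
        unfolding g using uw by (auto simp: mult_ac intro!: prod.cong)
    qed (use uw in auto)
  qed
  finally show ?thesis .
qed

text \<open>The Laplace expansion of a determinant over \<open>GF(2)\<close>: the sum over \<open>Y\<close> of the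
  products of the two permanents counts pairs of bijections with complementary images. Swapping the
  two values at a vertex where both lie in \<open>T2\<close> cancels all pairs except those that take
  one value in \<open>T1\<close> and one in \<open>T2\<close> at every vertex, and these contribute
  the product of the permanents of \<open>T1\<close> and \<open>T2\<close>.\<close>

lemma mpermanent_exchange:
  assumes fin: "finite W" "finite T1" "finite T2" and disj: "T1 \<inter> T2 = {}"
    and per: "mpermanent G W T1 \<noteq> 0" "mpermanent G W T2 \<noteq> 0" and X: "X \<subseteq> T1"
  obtains Y where "Y \<subseteq> T2" "mpermanent G W (T1 - X \<union> Y) \<noteq> 0" "mpermanent G W (X \<union> (T2 - Y)) \<noteq> 0"
proof -
  define w where "w s t = (\<Prod>v\<in>W. inc G (s v) v * inc G (t v) v)" for s t
  define P where "P Y = bijs W (T1 - X \<union> Y) \<times> bijs W (X \<union> (T2 - Y))" for Y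
  define Om where "Om = (\<Union>Y\<in>Pow T2. P Y)"
  define D where "D s t = {v \<in> W. s v \<in> T2 \<and> t v \<in> T2}" for s t :: "_ \<Rightarrow> 'b"
  \<comment> \<open>\<open>?j\<close> sorts the two values at each vertex so that the one in
    \<open>T1\<close> comes first; \<open>?i\<close> undoes this, since pairs in \<open>Om\<close>
    have the elements of \<open>X\<close> in the image of their second map.\<close>
  let ?i = "\<lambda>(s :: _ \<Rightarrow> 'b, t :: _ \<Rightarrow> 'b). (\<lambda>v. if s v \<in> X then t v else s v, \<lambda>v. if s v \<in> X then s v else t v)"
  let ?j = "\<lambda>(s :: _ \<Rightarrow> 'b, t :: _ \<Rightarrow> 'b). (\<lambda>v. if s v \<in> T1 then s v else t v, \<lambda>v. if s v \<in> T1 then t v else s v)"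
  \<comment> \<open>\<open>Om\<close> is described by images alone, so that swaps are easy to check;
    \<open>Y\<close> is recovered as the part of the image of \<open>s\<close> inside
    \<open>T2\<close>.\<close>
  have Om: "(s, t) \<in> Om \<longleftrightarrow> s \<in> extensional W \<and> t \<in> extensional W \<and> inj_on s W \<and> inj_on t W \<and>
      s ` W \<inter> t ` W = {} \<and> s ` W \<union> t ` W = T1 \<union> T2 \<and> s ` W \<inter> T1 = T1 - X" (is "_ \<longleftrightarrow> ?R") for s t
  proof
    assume "(s, t) \<in> Om"
    then obtain Y where "Y \<subseteq> T2" "s \<in> bijs W (T1 - X \<union> Y)" "t \<in> bijs W (X \<union> (T2 - Y))"
      by (auto simp: Om_def P_def)
    then show ?R using X disj by (auto simp: bijs_def PiE_def bij_betw_def)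
  next
    assume R: ?R
    have "B = X \<union> (T2 - A \<inter> T2)" "A = T1 - X \<union> A \<inter> T2"
      if "A \<inter> B = {}" "A \<union> B = T1 \<union> T2" "A \<inter> T1 = T1 - X" for A B
      using that X disj by blast+
    then have "t ` W = X \<union> (T2 - s ` W \<inter> T2)" "s ` W = T1 - X \<union> s ` W \<inter> T2"
      using R by metis+
    then have "bij_betw s W (T1 - X \<union> (s ` W \<inter> T2))" "bij_betw t W (X \<union> (T2 - s ` W \<inter> T2))"
      using R unfolding bij_betw_def by metis+
    then have "(s, t) \<in> P (s ` W \<inter> T2)" using R by (auto simp: P_def intro: bijsI)
    then show "(s, t) \<in> Om" by (auto simp: Om_def)
  qed
  have finP: "finite (P Y)" if "Y \<subseteq> T2" for Y
  proof -
    have "finite Y" "finite X" using that X fin finite_subset by auto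
    then show ?thesis unfolding P_def using fin by (intro finite_cartesian_product finite_bijs) auto
  qed
  have finOm: "finite Om" unfolding Om_def using fin finP by auto
  have per_w: "(\<Sum>(s, t)\<in>bijs W A \<times> bijs W B. w s t) = mpermanent G W A * mpermanent G W B" for A B
    by (simp only: mpermanent_def sum_product sum.cartesian_product w_def prod.distrib)
  have "(\<Sum>Y\<in>Pow T2. mpermanent G W (T1 - X \<union> Y) * mpermanent G W (X \<union> (T2 - Y))) = (\<Sum>Y\<in>Pow T2. \<Sum>(s, t)\<in>P Y. w s t)"
    by (simp add: P_def per_w)
  also have "\<dots> = (\<Sum>(s, t)\<in>Om. w s t)"
    unfolding Om_def
  proof (rule sum.UNION_disjoint[symmetric])
    show "finite (Pow T2)" using fin by simp
    show "\<forall>Y\<in>Pow T2. finite (P Y)" using finP by simp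
    have "Y = s ` W \<inter> T2" if "(s, t) \<in> P Y" "Y \<subseteq> T2" for s t Y
      using that disj by (auto simp: P_def bijs_def bij_betw_def)
    then show "\<forall>Y\<in>Pow T2. \<forall>Z\<in>Pow T2. Y \<noteq> Z \<longrightarrow> P Y \<inter> P Z = {}"
      by (metis (no_types) PowD disjoint_iff surj_pair)
  qed
  also have "\<dots> = (\<Sum>(s, t)\<in>{p \<in> Om. case p of (s, t) \<Rightarrow> D s t \<noteq> {}}. w s t)
      + (\<Sum>(s, t)\<in>{p \<in> Om. case p of (s, t) \<Rightarrow> D s t = {}}. w s t)"
    using finOm by (subst sum.union_disjoint[symmetric]) (auto intro!: sum.cong)
  also have "(\<Sum>(s, t)\<in>{p \<in> Om. case p of (s, t) \<Rightarrow> D s t \<noteq> {}}. w s t) = 0"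
  proof (rule sum_bit_involution)
    \<comment> \<open>The choice depends on the set \<open>D s t\<close> alone, which the swap
      preserves, so a second swap happens at the same vertex and restores the pair.\<close>
    define c where "c s t = (SOME v. v \<in> D s t)" for s t
    define i where "i = (\<lambda>(s, t). (s(c s t := t (c s t)), t(c s t := s (c s t))))"
    show "finite {p \<in> Om. case p of (s, t) \<Rightarrow> D s t \<noteq> {}}" using finOm by simp
    fix p assume p: "p \<in> {p \<in> Om. case p of (s, t) \<Rightarrow> D s t \<noteq> {}}"
    obtain s t where st: "p = (s, t)" by fastforce
    define v where "v = c s t"
    have "D s t \<noteq> {}" using p st by simp
    then have "v \<in> D s t" unfolding v_def c_def by (rule some_in_eq[THEN iffD2])
    then have v: "v \<in> W" "s v \<in> T2" "t v \<in> T2" by (auto simp: D_def)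
    have i: "i p = (s(v := t v), t(v := s v))" by (simp add: i_def st v_def)
    have D: "D (s(v := t v)) (t(v := s v)) = D s t" by (auto simp: D_def v)
    then have c: "c (s(v := t v)) (t(v := s v)) = v" by (simp add: c_def v_def)
    have O: "s \<in> extensional W" "t \<in> extensional W" "inj_on s W" "inj_on t W"
      "s ` W \<inter> t ` W = {}" "s ` W \<union> t ` W = T1 \<union> T2" "s ` W \<inter> T1 = T1 - X"
      using p st Om[of s t] by auto
    have im: "f ` W = insert (f v) (f ` (W - {v}))" for f :: "_ \<Rightarrow> 'b" using v by auto
    have im': "(f(v := x)) ` W = insert x (f ` (W - {v}))" for f :: "_ \<Rightarrow> 'b" and x using v by auto
    have "s v \<notin> s ` (W - {v})" "t v \<notin> t ` (W - {v})"
      using O(3,4) v by (auto simp: inj_on_def)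
    then have "s v \<notin> s ` (W - {v})" "t v \<notin> t ` (W - {v})" "s v \<notin> t ` W" "t v \<notin> s ` W"
      using O(5) v(1) by blast+
    then have "(s(v := t v)) ` W \<inter> (t(v := s v)) ` W = {}"
      using O(5) unfolding im' im[of s] im[of t] by simp
    moreover have "(s(v := t v)) ` W \<union> (t(v := s v)) ` W = T1 \<union> T2"
      unfolding O(6)[symmetric] im' im[of s] im[of t] by (simp add: insert_commute)
    moreover have "(s(v := t v)) ` W \<inter> T1 = T1 - X"
    proof -
      have "s v \<notin> T1" "t v \<notin> T1" using v disj by auto
      then show ?thesis unfolding O(7)[symmetric] im' im[of s] by simp
    qed
    moreover have "inj_on (s(v := t v)) W" "inj_on (t(v := s v)) W"
      using O(3-5) v by (auto intro!: inj_on_fun_updI)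
    moreover have "s(v := t v) \<in> extensional W" "t(v := s v) \<in> extensional W"
      using O(1,2) v by (auto simp: extensional_def)
    ultimately have "(s(v := t v), t(v := s v)) \<in> Om" unfolding Om by blast
    then show "i p \<in> {p \<in> Om. case p of (s, t) \<Rightarrow> D s t \<noteq> {}}"
      using \<open>D s t \<noteq> {}\<close> D by (simp add: i)
    show "i (i p) = p" unfolding i by (simp add: i_def c st)
    have "s v \<noteq> t v" using O(5) v by blast
    then show "i p \<noteq> p" unfolding i by (metis fun_upd_same prod.inject st)
    have "w (s(v := t v)) (t(v := s v)) = w s t"
      unfolding w_def by (rule prod.cong) (auto simp: mult.commute)
    then show "(case i p of (s, t) \<Rightarrow> w s t) = (case p of (s, t) \<Rightarrow> w s t)"
      unfolding i by (simp add: st)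
  qed
  also have "(\<Sum>(s, t)\<in>{p \<in> Om. case p of (s, t) \<Rightarrow> D s t = {}}. w s t) =
      (\<Sum>(s, t)\<in>bijs W T1 \<times> bijs W T2. w s t)"
  proof (rule sum.reindex_bij_witness[where i = ?i and j = ?j])
    {
      fix p assume p: "p \<in> {p \<in> Om. case p of (s, t) \<Rightarrow> D s t = {}}"
      obtain s t where st: "p = (s, t)" by fastforce
      have O: "s \<in> extensional W" "t \<in> extensional W" "inj_on s W" "inj_on t W"
        "s ` W \<inter> t ` W = {}" "s ` W \<union> t ` W = T1 \<union> T2" "s ` W \<inter> T1 = T1 - X"
        using p st Om[of s t] by auto
      define Ws where "Ws = {v \<in> W. s v \<in> T2}"
      define Wt where "Wt = {v \<in> W. t v \<in> T2}"
      have finW: "finite Ws" "finite Wt" using fin by (auto simp: Ws_def Wt_def)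
      have "Ws \<inter> Wt = {}" using p by (auto simp: st D_def Ws_def Wt_def)
      \<comment> \<open>\<open>T2\<close> is covered by the values of \<open>s\<close> on
        \<open>Ws\<close> and of \<open>t\<close> on \<open>Wt\<close>. As it has as many elements
        as \<open>W\<close>, these disjoint sets fill \<open>W\<close>: each vertex has exactly one
        value in \<open>T2\<close>.\<close>
      have "card W = card T2" using mpermanent_nonzero_card[OF per(2)] by simp
      also have "T2 = s ` Ws \<union> t ` Wt" using O(6) by (auto simp: Ws_def Wt_def)
      also have "card \<dots> \<le> card (s ` Ws) + card (t ` Wt)" by (rule card_Un_le)
      also have "\<dots> \<le> card Ws + card Wt" using finW by (intro add_mono card_image_le)
      also have "\<dots> = card (Ws \<union> Wt)" using \<open>Ws \<inter> Wt = {}\<close> finW by (simp add: card_Un_disjoint)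
      finally have "Ws \<union> Wt = W" using fin by (intro card_seteq) (auto simp: Ws_def Wt_def)
      then have one: "s v \<in> T1 \<and> t v \<in> T2 \<and> t v \<notin> T1 \<and> s v \<notin> X \<or> s v \<in> T2 \<and> t v \<in> T1 \<and> s v \<notin> T1 \<and> t v \<in> X"
        if "v \<in> W" for v
      proof -
        have "s v \<in> T1 \<union> T2" "t v \<in> T1 \<union> T2" using O(6) that by blast+
        moreover have "t v \<in> X" if "t v \<in> T1" using O(5,7) that \<open>v \<in> W\<close> by blast
        moreover have "s v \<notin> X" if "s v \<in> T1" using O(7) that \<open>v \<in> W\<close> by blast
        moreover have "v \<in> Ws \<or> v \<in> Wt" using \<open>Ws \<union> Wt = W\<close> that by blast
        moreover have "\<not> (v \<in> Ws \<and> v \<in> Wt)" using \<open>Ws \<inter> Wt = {}\<close> by blast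
        moreover have "\<not> (x \<in> T1 \<and> x \<in> T2)" for x using disj by blast
        ultimately show ?thesis using that unfolding Ws_def Wt_def by blast
      qed
      have out: "s v = undefined" "t v = undefined" if "v \<notin> W" for v
        using O(1,2) that by (auto simp: extensional_def)
      show "?i (?j p) = p"
        unfolding st using one out X by (auto simp: fun_eq_iff) (metis subsetD)+
      define a where "a v = (if s v \<in> T1 then s v else t v)" for v
      define b where "b v = (if s v \<in> T1 then t v else s v)" for v
      have ab: "s v \<in> T1 \<and> a v = s v \<and> b v = t v \<or> s v \<notin> T1 \<and> a v = t v \<and> b v = s v" for v
        by (auto simp: a_def b_def)
      have ne: "s v \<noteq> t w" if "v \<in> W" "w \<in> W" for v w using O(5) that by blast
      have "inj_on a W" "inj_on b W" using O(3,4) ab ne unfolding inj_on_def by metis+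
      moreover have "a v \<in> T1" "b v \<in> T2" if "v \<in> W" for v using one[OF that] ab[of v] by metis+
      moreover have "x \<in> a ` W" if "x \<in> T1" for x
      proof -
        obtain v where "v \<in> W" "x = s v \<or> x = t v" using O(6) \<open>x \<in> T1\<close> by blast
        then have "x = a v" using one[of v] ab[of v] \<open>x \<in> T1\<close> by metis
        then show ?thesis using \<open>v \<in> W\<close> by blast
      qed
      moreover have "x \<in> b ` W" if "x \<in> T2" for x
      proof -
        obtain v where "v \<in> W" "x = s v \<or> x = t v" using O(6) \<open>x \<in> T2\<close> by blast
        moreover have "x \<notin> T1" using disj \<open>x \<in> T2\<close> by blast
        ultimately have "x = b v" using one[of v] ab[of v] by metis
        then show ?thesis using \<open>v \<in> W\<close> by blast
      qed
      ultimately have "bij_betw a W T1" "bij_betw b W T2"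
        unfolding bij_betw_def by blast+
      moreover have "a \<in> extensional W" "b \<in> extensional W"
        using out by (simp_all add: a_def b_def extensional_def)
      ultimately have "a \<in> bijs W T1" "b \<in> bijs W T2" by (blast intro: bijsI)+
      then show "?j p \<in> bijs W T1 \<times> bijs W T2"
        by (simp add: st a_def[abs_def] b_def[abs_def])
      have "w (\<lambda>v. if s v \<in> T1 then s v else t v) (\<lambda>v. if s v \<in> T1 then t v else s v) = w s t"
        unfolding w_def by (rule prod.cong) (auto simp: mult.commute)
      then show "(case ?j p of (s, t) \<Rightarrow> w s t) = (case p of (s, t) \<Rightarrow> w s t)" by (simp add: st)
    }
    fix p assume p: "p \<in> bijs W T1 \<times> bijs W T2"
    obtain s t where st: "p = (s, t)" by fastforce
    have O: "s \<in> extensional W" "t \<in> extensional W" "inj_on s W" "inj_on t W" "s ` W = T1" "t ` W = T2"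
      using p by (auto simp: st bijs_def PiE_def bij_betw_def)
    have mem: "s v \<in> T1" "t v \<in> T2" "t v \<notin> T1" "s v \<notin> T2" "t v \<notin> X" if "v \<in> W" for v
      using that O(5,6) disj X by auto
    have out: "s v = undefined" "t v = undefined" if "v \<notin> W" for v
      using O(1,2) that by (auto simp: extensional_def)
    have "(if (if s v \<in> X then t v else s v) \<in> T1 then if s v \<in> X then t v else s v
        else if s v \<in> X then s v else t v) = s v"
      "(if (if s v \<in> X then t v else s v) \<in> T1 then if s v \<in> X then s v else t v
        else if s v \<in> X then t v else s v) = t v" for v
      using mem[of v] out[of v] by (cases "v \<in> W"; simp)+
    then show "?j (?i p) = p" by (simp only: st prod.case)
    show "?i p \<in> {p \<in> Om. case p of (s, t) \<Rightarrow> D s t = {}}"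
    proof -
      define a where "a v = (if s v \<in> X then t v else s v)" for v
      define b where "b v = (if s v \<in> X then s v else t v)" for v
      have ab: "s v \<in> X \<and> a v = t v \<and> b v = s v \<or> s v \<notin> X \<and> a v = s v \<and> b v = t v" for v
        by (auto simp: a_def b_def)
      have ne: "s v \<noteq> t w" if "v \<in> W" "w \<in> W" for v w using mem that by metis
      have "a ` W \<inter> T1 = T1 - X"
      proof
        have "a v \<notin> X" if "v \<in> W" for v using ab[of v] mem(5)[OF that] by metis
        then show "a ` W \<inter> T1 \<subseteq> T1 - X" by blast
        show "T1 - X \<subseteq> a ` W \<inter> T1" 
        proof
          fix x assume x: "x \<in> T1 - X"
          then obtain v where "v \<in> W" "x = s v" using O(5) by blast
          then have "x = a v" using x by (simp add: a_def)
          then show "x \<in> a ` W \<inter> T1" using x \<open>v \<in> W\<close> by blast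
        qed
      qed
      moreover have "a ` W \<union> b ` W = T1 \<union> T2"
      proof -
        have "a ` W \<union> b ` W = (\<Union>v\<in>W. {a v, b v})" by auto
        also have "\<dots> = (\<Union>v\<in>W. {s v, t v})" by (auto simp: a_def b_def)
        finally show ?thesis using O(5,6) by auto
      qed
      moreover have "inj_on a W" "inj_on b W"
        using O(3,4) ab ne unfolding inj_on_def by metis+
      moreover have "a ` W \<inter> b ` W = {}"
      proof -
        have "a v \<noteq> b w" if "v \<in> W" "w \<in> W" for v w
          using O(3,4) ab ne that unfolding inj_on_def by metis
        then show ?thesis by auto
      qed
      moreover have "a \<in> extensional W" "b \<in> extensional W"
        using out by (auto simp: a_def b_def extensional_def)
      moreover have "D a b = {}"
      proof -
        have "\<not> (a v \<in> T2 \<and> b v \<in> T2)" if "v \<in> W" for v using ab[of v] mem(4)[OF that] by metis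
        then show ?thesis unfolding D_def by blast
      qed
      ultimately show ?thesis unfolding st using Om[of a b] by (simp add: a_def[abs_def] b_def[abs_def])
    qed
  qed
  also have "\<dots> = 1" using per by (simp add: per_w)
  finally have "(\<Sum>Y\<in>Pow T2. mpermanent G W (T1 - X \<union> Y) * mpermanent G W (X \<union> (T2 - Y))) \<noteq> 0" by simp
  then obtain Y where "Y \<subseteq> T2" "mpermanent G W (T1 - X \<union> Y) * mpermanent G W (X \<union> (T2 - Y)) \<noteq> 0"
    by (metis (mono_tags, lifting) PowD sum.not_neutral_contains_not_neutral)
  then show ?thesis by (intro that) auto
qed

section \<open>Connected spanning edge sets and odd permanents\<close>

context finite_multigraph
begin

lemma finite_sub: "S \<subseteq> medges G \<Longrightarrow> finite S"
  using finite_medges finite_subset by blast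

lemma ends_cases:
  assumes "e \<in> medges G"
  obtains a b where "mends G e = Upair a b" "a \<in> mverts G" "b \<in> mverts G"
  using mends_in_mverts[OF assms] by (cases "mends G e") auto

lemma madj_iff: "(u, v) \<in> madj (G\<lparr>medges := S\<rparr>) \<longleftrightarrow> (\<exists>e\<in>S. mends G e = Upair u v)"
  by (simp add: madj_def)

lemma sum_inc_vertices:
  assumes "finite C" "mends G e = Upair a b"
  shows "(\<Sum>w\<in>C. inc G e w) = of_bool (a \<in> C) + of_bool (b \<in> C)"
  unfolding inc_Upair[OF assms(2)] sum.distrib of_bool_def using assms(1) by (simp add: sum.delta)

text \<open>Every edge of \<open>S\<close> has both or neither of its ends in the set
  \<open>C\<close> of vertices that \<open>r\<close> does not reach. If \<open>C\<close> were
  nonempty, its rows would add up to 0 on \<open>S\<close> and the permanent would vanish.\<close>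

lemma connecting_if_mpermanent_nonzero:
  assumes S: "S \<subseteq> medges G" and r: "r \<in> mverts G" and per: "mpermanent G (mverts G - {r}) S \<noteq> 0"
  shows "mconnecting G S"
proof -
  let ?R = "madj (G\<lparr>medges := S\<rparr>)"
  have sym: "sym ?R" unfolding sym_def madj_iff by (metis Upair_inject)
  define C where "C = {v \<in> mverts G. (r, v) \<notin> ?R\<^sup>*}"
  have "C = {}"
  proof (rule ccontr)
    assume "C \<noteq> {}"
    have "mpermanent G (mverts G - {r}) S = 0"
    proof (rule mpermanent_disconnected)
      show "finite (mverts G - {r})" using finite_mverts by simp
      show "finite S" using S by (rule finite_sub)
      show "C \<subseteq> mverts G - {r}" by (auto simp: C_def)
      show "C \<noteq> {}" by fact
      fix e assume e: "e \<in> S"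
      obtain a b where ab: "mends G e = Upair a b" "a \<in> mverts G" "b \<in> mverts G"
        using e S ends_cases by blast
      have "(a, b) \<in> ?R" using e ab by (auto simp: madj_iff)
      moreover have "(b, a) \<in> ?R" using calculation sym by (auto simp: sym_def)
      ultimately have "a \<in> C \<longleftrightarrow> b \<in> C"
        using ab by (auto simp: C_def intro: rtrancl_into_rtrancl)
      moreover have "finite C" by (simp add: C_def finite_mverts)
      ultimately show "(\<Sum>w\<in>C. inc G e w) = 0"
        using sum_inc_vertices[OF _ ab(1)] by simp
    qed
    with per show False by simp
  qed
  then have reach: "(r, v) \<in> ?R\<^sup>*" if "v \<in> mverts G" for v using that by (auto simp: C_def)
  moreover have "(v, r) \<in> ?R\<^sup>*" if "v \<in> mverts G" for v
    using reach[OF that] sym_rtrancl[OF sym] by (auto simp: sym_def)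
  ultimately show ?thesis using r unfolding mconnected_def by (auto intro: rtrancl_trans)
qed

text \<open>\<open>T0\<close> is a breadth-first tree with root \<open>r\<close>. Assigning to each
  vertex its parent edge is the only bijection with a nonzero product.\<close>

lemma connecting_obtains_tree:
  assumes T: "T \<subseteq> medges G" and r: "r \<in> mverts G" and conn: "mconnecting G T"
  obtains T0 where "T0 \<subseteq> T" "mpermanent G (mverts G - {r}) T0 = 1"
proof -
  let ?R = "madj (G\<lparr>medges := T\<rparr>)" and ?W = "mverts G - {r}"
  \<comment> \<open>The distance from \<open>r\<close> inside \<open>T\<close>; the last edge of a
    shortest walk to \<open>v\<close> comes from a vertex closer to \<open>r\<close>.\<close>
  define d where "d v = (LEAST k. (r, v) \<in> ?R ^^ k)" for v
  have "\<exists>e\<in>T. \<exists>u. mends G e = Upair u v \<and> d u < d v" if v: "v \<in> ?W" for v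
  proof -
    have "\<exists>k. (r, v) \<in> ?R ^^ k"
      using conn r v by (auto simp: mconnected_def rtrancl_power)
    then have dv: "(r, v) \<in> ?R ^^ d v" unfolding d_def by (rule LeastI_ex)
    then obtain k where k: "d v = Suc k" using v by (cases "d v") auto
    with dv obtain u where u: "(r, u) \<in> ?R ^^ k" "(u, v) \<in> ?R" by auto
    have "d u \<le> k" unfolding d_def using u(1) by (rule Least_le)
    then have "d u < d v" using k by simp
    with u(2) show ?thesis by (auto simp: madj_iff)
  qed
  then obtain p q where pq: "\<And>v. v \<in> ?W \<Longrightarrow> p v \<in> T \<and> mends G (p v) = Upair (q v) v \<and> d (q v) < d v"
    by metis
  define T0 where "T0 = p ` ?W"
  have inj: "inj_on p ?W"
  proof (rule inj_onI)
    fix v w assume "v \<in> ?W" "w \<in> ?W" "p v = p w"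
    with pq[of v] pq[of w] show "v = w" by (auto simp: Upair_inject)
  qed
  define p' where "p' = restrict p ?W"
  have finW: "finite ?W" using finite_mverts by simp
  have p': "p' \<in> bijs ?W T0"
    unfolding p'_def T0_def using inj by (intro bijsI) (auto simp: bij_betw_def inj_on_def)
  have finB: "finite (bijs ?W T0)" using finW by (intro finite_bijs) (simp_all add: T0_def)
  \<comment> \<open>The edge \<open>t v\<close> is the parent edge of \<open>v\<close> or of a child of \<open>v\<close>; since the depths of these
    owners add up to the same total, no child can occur.\<close>
  have uniq: "t = p'" if t: "t \<in> bijs ?W T0" and nz: "(\<Prod>v\<in>?W. inc G (t v) v) \<noteq> 0" for t
  proof -
    have bt: "bij_betw t ?W T0" using t by (simp add: bijs_def)
    have bp: "bij_betw p ?W T0" using inj by (simp add: T0_def bij_betw_def)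
    \<comment> \<open>\<open>s v\<close> is the owner of the edge \<open>t v\<close>: the vertex
      whose parent edge it is.\<close>
    define s where "s = inv_into ?W p \<circ> t"
    have bs: "bij_betw s ?W ?W"
      unfolding s_def by (rule bij_betw_trans[OF bt bij_betw_inv_into[OF bp]])
    have ps: "p (s v) = t v" "s v \<in> ?W" if "v \<in> ?W" for v
    proof -
      have "t v \<in> p ` ?W" using bij_betwE[OF bt] that by (simp add: T0_def)
      then show "p (s v) = t v" unfolding s_def comp_def by (rule f_inv_into_f)
      show "s v \<in> ?W" using bij_betwE[OF bs] that by blast
    qed
    have up: "d v \<le> d (s v) \<and> (d v = d (s v) \<longrightarrow> s v = v)" if v: "v \<in> ?W" for v
    proof -
      have "inc G (t v) v \<noteq> 0"
      proof
        assume "inc G (t v) v = 0"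
        then have "(\<Prod>v\<in>?W. inc G (t v) v) = 0" using v by (intro prod_zero[OF finW]) blast
        with nz show False by contradiction
      qed
      then have "v \<in> set_uprod (mends G (p (s v)))" unfolding ps(1)[OF v] by (rule inc_nonzeroD)
      moreover have "mends G (p (s v)) = Upair (q (s v)) (s v)" "d (q (s v)) < d (s v)"
        using pq[OF ps(2)[OF v]] by blast+
      ultimately have "v = q (s v) \<or> v = s v" by simp
      with \<open>d (q (s v)) < d (s v)\<close> show ?thesis by (metis less_imp_le_nat less_irrefl order_refl)
    qed
    have "(\<Sum>v\<in>?W. d (s v)) = (\<Sum>v\<in>?W. d v)" by (rule sum.reindex_bij_betw[OF bs])
    then have "d v = d (s v)" if "v \<in> ?W" for v
      by (intro sum_mono_inv[of d ?W "\<lambda>v. d (s v)"]) (use that up finW in auto)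
    then have "t v = p v" if "v \<in> ?W" for v using up[OF that] ps(1)[OF that] that by metis
    moreover have "t \<in> extensional ?W" using t by (auto simp: bijs_def PiE_def)
    ultimately show ?thesis by (auto simp: p'_def extensional_def)
  qed
  have "(\<Prod>v\<in>?W. inc G (p' v) v) = 1"
  proof (rule prod.neutral, rule ballI)
    fix v assume v: "v \<in> ?W"
    have p: "mends G (p v) = Upair (q v) v" and "q v \<noteq> v" using pq[OF v] by auto
    then show "inc G (p' v) v = 1" using v inc_Upair[OF p, of v] by (simp add: p'_def)
  qed
  moreover have "mpermanent G ?W T0 = (\<Prod>v\<in>?W. inc G (p' v) v) +
      (\<Sum>t\<in>bijs ?W T0 - {p'}. \<Prod>v\<in>?W. inc G (t v) v)"
    unfolding mpermanent_def by (rule sum.remove[OF finB p'])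
  moreover have "(\<Sum>t\<in>bijs ?W T0 - {p'}. \<Prod>v\<in>?W. inc G (t v) v) = 0"
    using uniq by (intro sum.neutral) blast
  ultimately have "mpermanent G ?W T0 = 1" by simp
  moreover have "T0 \<subseteq> T" using pq by (auto simp: T0_def)
  ultimately show ?thesis by (rule that[rotated])
qed

section \<open>Flows modulo 2 and their extension from prescribed values\<close>

text \<open>The cycle space over GF(2). Values outside \<open>medges G\<close> do not matter, so
  linear combinations need no restriction.\<close>

definition meven :: "('e \<Rightarrow> bit) \<Rightarrow> bool" where
  "meven A \<longleftrightarrow> (\<forall>v\<in>mverts G. (\<Sum>e\<in>medges G. A e * inc G e v) = 0)"

text \<open>\<open>g\<close> counts modulo 2 how often a walk from \<open>u\<close> to
  \<open>v\<close> uses each edge; one more edge moves the second end.\<close>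

lemma boundary_path:
  assumes S: "S \<subseteq> medges G" and "(u, v) \<in> (madj (G\<lparr>medges := S\<rparr>))\<^sup>*"
  shows "\<exists>g :: 'e \<Rightarrow> bit. (\<forall>e. e \<notin> S \<longrightarrow> g e = 0) \<and>
    (\<forall>w. (\<Sum>e\<in>medges G. g e * inc G e w) = of_bool (w = u) + of_bool (w = v))"
  using assms(2)
proof (induction rule: rtrancl_induct)
  case base
  show ?case by (rule exI[of _ "\<lambda>_. 0"]) simp
next
  case (step v v')
  then obtain g :: "'e \<Rightarrow> bit" where g: "\<And>e. e \<notin> S \<Longrightarrow> g e = 0"
    "\<And>w. (\<Sum>e\<in>medges G. g e * inc G e w) = of_bool (w = u) + of_bool (w = v)" by blast
  obtain e where e: "e \<in> S" "mends G e = Upair v v'" using step.hyps by (auto simp: madj_iff)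
  let ?g = "\<lambda>x. g x + of_bool (x = e)"
  have "(\<Sum>x\<in>medges G. ?g x * inc G x w) = of_bool (w = u) + of_bool (w = v')" for w
  proof -
    have "(\<Sum>x\<in>medges G. ?g x * inc G x w) =
        of_bool (w = u) + of_bool (w = v) + (\<Sum>x\<in>medges G. of_bool (x = e) * inc G x w)"
      by (simp only: distrib_right sum.distrib g(2))
    also have "(\<Sum>x\<in>medges G. of_bool (x = e) * inc G x w) = (\<Sum>x\<in>medges G. if x = e then inc G e w else 0)"
      by (rule sum.cong) auto
    also have "\<dots> = inc G e w" using e S finite_medges by (subst sum.delta) auto
    also have "\<dots> = of_bool (w = v) + of_bool (w = v')" by (rule inc_Upair[OF e(2)])
    finally show ?thesis by (auto simp: of_bool_def split: if_splits)
  qed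
  then show ?case using g(1) e(1) by (intro exI[of _ ?g]) auto
qed

text \<open>An edge \<open>e\<close> outside \<open>S\<close> together with a walk in
  \<open>S\<close> between its ends gives an even function \<open>c e\<close> that outside
  \<open>S\<close> is 1 only at \<open>e\<close>. Combining these with coefficients
  \<open>f e\<close> produces the prescribed values.\<close>

lemma meven_extension:
  assumes S: "S \<subseteq> medges G" "mconnecting G S"
  shows "\<exists>A. meven A \<and> (\<forall>e\<in>medges G - S. A e = f e)"
proof -
  have "\<exists>c :: 'e \<Rightarrow> bit. meven c \<and> (\<forall>x\<in>medges G - S. c x = of_bool (x = e))" if e: "e \<in> medges G" for e
  proof -
    obtain a b where ab: "mends G e = Upair a b" "a \<in> mverts G" "b \<in> mverts G" using ends_cases[OF e] .
    have "(a, b) \<in> (madj (G\<lparr>medges := S\<rparr>))\<^sup>*" using S ab by (simp add: mconnected_def)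
    from boundary_path[OF S(1) this] obtain g :: "'e \<Rightarrow> bit" where g: "\<And>x. x \<notin> S \<Longrightarrow> g x = 0"
      "\<And>w. (\<Sum>x\<in>medges G. g x * inc G x w) = of_bool (w = a) + of_bool (w = b)" by blast
    let ?c = "\<lambda>x. g x + of_bool (x = e)"
    have "(\<Sum>x\<in>medges G. ?c x * inc G x w) = 0" for w
    proof -
      have "(\<Sum>x\<in>medges G. ?c x * inc G x w) =
          of_bool (w = a) + of_bool (w = b) + (\<Sum>x\<in>medges G. of_bool (x = e) * inc G x w)"
        by (simp only: distrib_right sum.distrib g(2))
      also have "(\<Sum>x\<in>medges G. of_bool (x = e) * inc G x w) = (\<Sum>x\<in>medges G. if x = e then inc G e w else 0)"
        by (rule sum.cong) auto
      also have "\<dots> = of_bool (w = a) + of_bool (w = b)"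
        using e finite_medges inc_Upair[OF ab(1)] by (subst sum.delta) auto
      finally show ?thesis by (simp add: bit_add_eq_0_iff)
    qed
    then show ?thesis using g(1) by (intro exI[of _ ?c]) (auto simp: meven_def)
  qed
  then obtain c :: "'e \<Rightarrow> 'e \<Rightarrow> bit" where c: "\<And>e. e \<in> medges G \<Longrightarrow> meven (c e)"
    "\<And>e x. e \<in> medges G \<Longrightarrow> x \<in> medges G - S \<Longrightarrow> c e x = of_bool (x = e)" by metis
  define A where "A x = (\<Sum>e\<in>medges G - S. f e * c e x)" for x
  show ?thesis
  proof (intro exI[of _ A] conjI ballI)
    have "(\<Sum>x\<in>medges G. A x * inc G x v) = 0" if v: "v \<in> mverts G" for v
    proof -
      have "(\<Sum>x\<in>medges G. A x * inc G x v) = (\<Sum>e\<in>medges G - S. \<Sum>x\<in>medges G. f e * (c e x * inc G x v))"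
        unfolding A_def sum_distrib_right by (subst sum.swap) (simp add: mult.assoc)
      also have "\<dots> = (\<Sum>e\<in>medges G - S. f e * (\<Sum>x\<in>medges G. c e x * inc G x v))"
        by (simp only: sum_distrib_left)
      also have "\<dots> = 0" using c(1) v by (intro sum.neutral) (auto simp: meven_def)
      finally show ?thesis .
    qed
    then show "meven A" by (simp add: meven_def)
    fix x assume x: "x \<in> medges G - S"
    have "A x = (\<Sum>e\<in>medges G - S. if x = e then f e else 0)"
      unfolding A_def using c(2) x by (intro sum.cong) auto
    then show "A x = f x" using x finite_medges by (simp add: sum.delta)
  qed
qed

text \<open>A loop counted twice contributes 0 modulo 2, just as it does through \<open>inc\<close>,
  so the flow condition holds in each component.\<close>

lemma meven_pair_flow:
  assumes "meven A" "meven B"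
  shows "(\<lambda>e\<in>medges G. (A e, B e)) \<in> mflows G"
proof -
  have half: "(\<Sum>e\<in>{e \<in> medges G. v \<in> set_uprod (mends G e)}.
      if mends G e = Upair v v then F e + F e else F e) = 0"
    if "meven F" "v \<in> mverts G" for F v
  proof -
    have "(\<Sum>e\<in>{e \<in> medges G. v \<in> set_uprod (mends G e)}.
        if mends G e = Upair v v then F e + F e else F e) = (\<Sum>e\<in>medges G. F e * inc G e v)"
      using finite_medges by (intro sum.mono_neutral_cong_left) (auto simp: inc_def)
    then show ?thesis using that by (simp add: meven_def)
  qed
  have "(\<Sum>e\<in>{e \<in> medges G. v \<in> set_uprod (mends G e)}.
      if mends G e = Upair v v then (\<lambda>e\<in>medges G. (A e, B e)) e + (\<lambda>e\<in>medges G. (A e, B e)) e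
      else (\<lambda>e\<in>medges G. (A e, B e)) e) = 0" (is "sum ?f ?I = 0") if v: "v \<in> mverts G" for v
  proof (rule prod_eqI)
    have "fst (sum ?f ?I) = (\<Sum>e\<in>?I. if mends G e = Upair v v then A e + A e else A e)"
      unfolding fst_sum by (rule sum.cong) auto
    then show "fst (sum ?f ?I) = fst 0" using half[OF assms(1) v] by simp
    have "snd (sum ?f ?I) = (\<Sum>e\<in>?I. if mends G e = Upair v v then B e + B e else B e)"
      unfolding snd_sum by (rule sum.cong) auto
    then show "snd (sum ?f ?I) = snd 0" using half[OF assms(2) v] by simp
  qed
  then show ?thesis unfolding mflows_def by auto
qed

section \<open>Counting nowhere-zero flows with prescribed values\<close>

lemma finite_nz_flows: "finite (nowhere_zero_mflows G :: ('e \<Rightarrow> bit \<times> bit) set)"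
proof (rule finite_subset)
  have "(UNIV :: (bit \<times> bit) set) = {0, 1} \<times> {0, 1}"
    by (auto simp flip: bit_not_one_iff)
  then have "finite (UNIV :: (bit \<times> bit) set)" by (metis finite.intros finite_SigmaI)
  then show "finite (medges G \<rightarrow>\<^sub>E (UNIV :: (bit \<times> bit) set))"
    using finite_medges by (intro finite_PiE)
qed (auto simp: nowhere_zero_mflows_def mflows_def)

lemma meven_pair_nz_flow:
  assumes "meven A" "meven B" "\<And>e. e \<in> medges G \<Longrightarrow> A e \<noteq> 0 \<or> B e \<noteq> 0"
  shows "(\<lambda>e\<in>medges G. (A e, B e)) \<in> nowhere_zero_mflows G"
  using meven_pair_flow[OF assms(1,2)] assms(3)
  by (auto simp: nowhere_zero_mflows_def zero_prod_def)

text \<open>Nonzero values outside \<open>S1 \<union> S2\<close> are free: the first component is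
  set to 1 on \<open>S2\<close> and completed on \<open>S1\<close>, the second is set to 1 on
  \<open>S1\<close> and completed on \<open>S2\<close>. Restricting the flows thus reaches every
  choice.\<close>

lemma card_nz_flows_ge_power3:
  assumes S: "S1 \<subseteq> medges G" "S2 \<subseteq> medges G" "S1 \<inter> S2 = {}" "mconnecting G S1" "mconnecting G S2"
  shows "3 ^ card (medges G - (S1 \<union> S2)) \<le> card (nowhere_zero_mflows G :: ('e \<Rightarrow> bit \<times> bit) set)"
proof -
  let ?R = "medges G - (S1 \<union> S2)" and ?N = "nowhere_zero_mflows G :: ('e \<Rightarrow> bit \<times> bit) set"
  have nz: "{x :: bit \<times> bit. x \<noteq> 0} = {(0, 1), (1, 0), (1, 1)}"
    by (auto simp: zero_prod_def)
  have "?R \<rightarrow>\<^sub>E {x. x \<noteq> 0} \<subseteq> (\<lambda>\<phi>. restrict \<phi> ?R) ` ?N"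
  proof
    fix f :: "'e \<Rightarrow> bit \<times> bit" assume f: "f \<in> ?R \<rightarrow>\<^sub>E {x. x \<noteq> 0}"
    obtain A where A: "meven A" "\<And>e. e \<in> medges G - S1 \<Longrightarrow> A e = (if e \<in> S2 then 1 else fst (f e))"
      using meven_extension[OF S(1,4), of "\<lambda>e. if e \<in> S2 then 1 else fst (f e)"] by blast
    obtain B where B: "meven B" "\<And>e. e \<in> medges G - S2 \<Longrightarrow> B e = (if e \<in> S1 then 1 else snd (f e))"
      using meven_extension[OF S(2,5), of "\<lambda>e. if e \<in> S1 then 1 else snd (f e)"] by blast
    let ?p = "\<lambda>e\<in>medges G. (A e, B e)"
    have "f = restrict ?p ?R"
    proof
      fix e show "f e = restrict ?p ?R e"
        using f A(2)[of e] B(2)[of e] by (cases "e \<in> ?R") (auto simp: PiE_def extensional_def)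
    qed
    moreover have "?p \<in> ?N"
    proof (rule meven_pair_nz_flow[OF A(1) B(1)])
      fix e assume e: "e \<in> medges G"
      show "A e \<noteq> 0 \<or> B e \<noteq> 0"
      proof (cases "e \<in> ?R")
        case True
        then have "f e \<noteq> 0" using f by auto
        then show ?thesis using A(2)[of e] B(2)[of e] True by (auto simp: zero_prod_def prod_eq_iff)
      next
        case False
        then show ?thesis using A(2)[of e] B(2)[of e] e S(3) by (cases "e \<in> S1") (auto simp: disjoint_iff)
      qed
    qed
    ultimately show "f \<in> (\<lambda>\<phi>. restrict \<phi> ?R) ` ?N" by (rule image_eqI)
  qed
  then have "card (?R \<rightarrow>\<^sub>E {x :: bit \<times> bit. x \<noteq> 0}) \<le> card ?N"
    using finite_nz_flows by (rule surj_card_le[rotated])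
  moreover have "card (?R \<rightarrow>\<^sub>E {x :: bit \<times> bit. x \<noteq> 0}) = 3 ^ card ?R"
  proof -
    have three: "card {(0, 1), (1, 0), (1, 1) :: bit \<times> bit} = 3" by simp
    have "finite ?R" using finite_medges by simp
    then show ?thesis unfolding nz by (simp only: card_PiE three prod_constant)
  qed
  ultimately show ?thesis by simp
qed

text \<open>Among the edges of \<open>G\<close>, \<open>A\<close> vanishes only in
  \<open>S'\<close>, where the second component can still be prescribed because \<open>S'\<close>
  avoids \<open>S\<close>. It may be 0 on \<open>Q\<close>, since \<open>A\<close> is 1
  there.\<close>

lemma nz_flow_with_first:
  assumes S: "S \<subseteq> medges G" "mconnecting G S" and S': "S' \<inter> S = {}"
    and A: "meven A" "\<And>e. e \<in> medges G - S' \<Longrightarrow> A e = 1"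
    and Q: "Q \<subseteq> {e \<in> S'. A e = 1}"
  obtains \<phi> :: "'e \<Rightarrow> bit \<times> bit" where "\<phi> \<in> nowhere_zero_mflows G" "\<And>e. e \<in> medges G \<Longrightarrow> fst (\<phi> e) = A e"
    "\<And>e. e \<in> medges G - S \<Longrightarrow> snd (\<phi> e) = of_bool (e \<notin> Q)"
proof -
  obtain B where B: "meven B" "\<And>e. e \<in> medges G - S \<Longrightarrow> B e = of_bool (e \<notin> Q)"
    using meven_extension[OF S, of "\<lambda>e. of_bool (e \<notin> Q)"] by blast
  have "(\<lambda>e\<in>medges G. (A e, B e)) \<in> nowhere_zero_mflows G"
  proof (rule meven_pair_nz_flow[OF A(1) B(1)])
    fix e assume e: "e \<in> medges G"
    show "A e \<noteq> 0 \<or> B e \<noteq> 0"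
    proof (cases "A e = 1")
      case False
      then have "e \<in> S'" "e \<notin> Q" using A(2)[of e] e Q by auto
      then show ?thesis using B(2)[of e] e S' by auto
    qed simp
  qed
  then show ?thesis using B(2) by (intro that[of "\<lambda>e\<in>medges G. (A e, B e)"]) simp_all
qed

text \<open>Where \<open>A\<close> is 1 on \<open>S'\<close>, the zeros of the second component form
  an arbitrary set, which can be read off from the flow.\<close>

lemma card_nz_flows_ge_power2:
  assumes S: "S \<subseteq> medges G" "mconnecting G S" and S': "S' \<subseteq> medges G" "S' \<inter> S = {}"
    and A: "meven A" "\<And>e. e \<in> medges G - S' \<Longrightarrow> A e = 1"
  shows "2 ^ card {e \<in> S'. A e = 1} \<le> card (nowhere_zero_mflows G :: ('e \<Rightarrow> bit \<times> bit) set)"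
proof -
  let ?J = "{e \<in> S'. A e = 1}" and ?N = "nowhere_zero_mflows G :: ('e \<Rightarrow> bit \<times> bit) set"
  have "Pow ?J \<subseteq> (\<lambda>\<phi>. {e \<in> ?J. snd (\<phi> e) = 0}) ` ?N"
  proof
    fix Q assume Q: "Q \<in> Pow ?J"
    then obtain \<phi> where \<phi>: "\<phi> \<in> ?N" "\<And>e. e \<in> medges G - S \<Longrightarrow> snd (\<phi> e) = of_bool (e \<notin> Q)"
      using nz_flow_with_first[OF S S'(2) A] by (metis PowD)
    have "snd (\<phi> e) = of_bool (e \<notin> Q)" if "e \<in> ?J" for e using that S' by (intro \<phi>(2)) auto
    then have "{e \<in> ?J. snd (\<phi> e) = 0} = Q" using Q by auto
    then show "Q \<in> (\<lambda>\<phi>. {e \<in> ?J. snd (\<phi> e) = 0}) ` ?N" using \<phi>(1) by blast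
  qed
  then have "card (Pow ?J) \<le> card ?N" using finite_nz_flows by (rule surj_card_le[rotated])
  moreover have "finite ?J" using finite_sub[OF S'(1)] by simp
  ultimately show ?thesis by (simp add: card_Pow)
qed

section \<open>Counting tree splittings and first components\<close>

text \<open>Exchanging \<open>X \<subseteq> T1\<close> for a suitable part of \<open>T2\<close>
  gives a splitting with \<open>S \<inter> T1 = X\<close>, so different \<open>X\<close> give
  different \<open>S\<close>.\<close>

lemma card_tree_pairs_ge:
  assumes r: "r \<in> mverts G" and T: "T1 \<subseteq> medges G" "T2 \<subseteq> medges G" "T1 \<inter> T2 = {}"
    and per: "mpermanent G (mverts G - {r}) T1 \<noteq> 0" "mpermanent G (mverts G - {r}) T2 \<noteq> 0"
  shows "2 ^ card T1 \<le> card {S. S \<subseteq> T1 \<union> T2 \<and> card S = card T1 \<and>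
    mconnecting G S \<and> mconnecting G (T1 \<union> T2 - S)}" (is "_ \<le> card ?D")
proof -
  let ?W = "mverts G - {r}"
  have fin: "finite ?W" "finite T1" "finite T2" using finite_mverts T finite_sub by auto
  have "Pow T1 \<subseteq> (\<lambda>S. S \<inter> T1) ` ?D"
  proof
    fix X assume X: "X \<in> Pow T1"
    obtain Y where Y: "Y \<subseteq> T2" "mpermanent G ?W (T1 - X \<union> Y) \<noteq> 0" "mpermanent G ?W (X \<union> (T2 - Y)) \<noteq> 0"
      using mpermanent_exchange[OF fin T(3) per] X by blast
    let ?S = "X \<union> (T2 - Y)"
    have "mconnecting G ?S" "mconnecting G (T1 - X \<union> Y)"
      using T X Y by (auto intro!: connecting_if_mpermanent_nonzero[OF _ r])
    moreover have "T1 \<union> T2 - ?S = T1 - X \<union> Y" using X Y(1) T(3) by auto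
    moreover have "card ?S = card T1" using mpermanent_nonzero_card per(1) Y(3) by metis
    moreover have "?S \<subseteq> T1 \<union> T2" using X by auto
    ultimately have "?S \<in> ?D" by simp
    moreover have "?S \<inter> T1 = X" using X T(3) by auto
    ultimately show "X \<in> (\<lambda>S. S \<inter> T1) ` ?D" by blast
  qed
  moreover have "finite ?D" by (rule finite_subset[of _ "Pow (T1 \<union> T2)"]) (use fin in auto)
  ultimately have "card (Pow T1) \<le> card ?D" by (rule surj_card_le[rotated])
  then show ?thesis using fin by (simp add: card_Pow)
qed

text \<open>Trees \<open>S\<close> with the same first component \<open>A\<close> are subsets of the support of \<open>A\<close>;
  if that is barely larger than a tree, few trees share it, so many first components occur.\<close>

lemma card_nz_flows_dichotomy:
  assumes r: "r \<in> mverts G" and T: "T1 \<subseteq> medges G" "T2 \<subseteq> medges G" "T1 \<inter> T2 = {}"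
    and per: "mpermanent G (mverts G - {r}) T1 \<noteq> 0" "mpermanent G (mverts G - {r}) T2 \<noteq> 0"
  defines "N \<equiv> card (nowhere_zero_mflows G :: ('e \<Rightarrow> bit \<times> bit) set)"
  shows "2 ^ Suc J \<le> N \<or> 2 ^ card T1 \<le> real N * (3 ^ J * (3 / 2) ^ card T1)"
proof -
  let ?H = "T1 \<union> T2" and ?M = "card T1" and ?F = "nowhere_zero_mflows G :: ('e \<Rightarrow> bit \<times> bit) set"
  define D where "D = {S. S \<subseteq> ?H \<and> card S = ?M \<and> mconnecting G S \<and> mconnecting G (?H - S)}"
  have finH: "finite ?H" using T finite_sub by auto
  have finD: "finite D" by (rule finite_subset[of _ "Pow ?H"]) (use finH in \<open>auto simp: D_def\<close>)
  have "\<exists>A. meven A \<and> (\<forall>e\<in>medges G - (?H - S). A e = 1)" if "S \<in> D" for S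
  proof -
    have "?H - S \<subseteq> medges G" "mconnecting G (?H - S)" using that T by (auto simp: D_def)
    then show ?thesis by (rule meven_extension)
  qed
  then obtain A where A: "\<And>S. S \<in> D \<Longrightarrow> meven (A S)"
    "\<And>S e. S \<in> D \<Longrightarrow> e \<in> medges G - (?H - S) \<Longrightarrow> A S e = 1" by metis
  \<comment> \<open>\<open>U S\<close> is the support of the first component within
    \<open>?H\<close>, and \<open>Q S\<close> is its excess over \<open>S\<close>.\<close>
  define U where "U S = {e \<in> ?H. A S e = 1}" for S
  define Q where "Q S = {e \<in> ?H - S. A S e = 1}" for S
  have UQ: "U S = S \<union> Q S" if "S \<in> D" for S
  proof -
    have "S \<subseteq> ?H" using that by (simp add: D_def)
    moreover have "A S e = 1" if "e \<in> S" for e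
      using A(2)[OF \<open>S \<in> D\<close>, of e] that \<open>S \<subseteq> ?H\<close> T by blast
    ultimately show ?thesis unfolding U_def Q_def by blast
  qed
  show ?thesis
  proof (cases "\<exists>S\<in>D. J < card (Q S)")
    case True
    then obtain S where S: "S \<in> D" "J < card (Q S)" by blast
    have "2 ^ card (Q S) \<le> N"
      unfolding N_def Q_def using S(1) A[OF S(1)] T
      by (intro card_nz_flows_ge_power2[of S]) (auto simp: D_def)
    moreover have "(2::nat) ^ Suc J \<le> 2 ^ card (Q S)" using S(2) by (intro power_increasing) auto
    ultimately show ?thesis by linarith
  next
    case False
    let ?K = "3 ^ J * (3 / 2) ^ ?M :: real"
    define I where "I = U ` D"
    \<comment> \<open>Each support is realized by a flow with first component \<open>A S\<close> and
      \<open>Q = {}\<close>, so there are at most \<open>N\<close> supports.\<close>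
    have "I \<subseteq> (\<lambda>\<phi>. {e \<in> ?H. fst (\<phi> e) = 1}) ` ?F"
    proof
      fix V assume "V \<in> I"
      then obtain S where S: "S \<in> D" "V = U S" by (auto simp: I_def)
      obtain \<phi> where \<phi>: "\<phi> \<in> ?F" "\<And>e. e \<in> medges G \<Longrightarrow> fst (\<phi> e) = A S e"
      proof -
        have "S \<subseteq> medges G" "mconnecting G S" "(?H - S) \<inter> S = {}" using S(1) T by (auto simp: D_def)
        from nz_flow_with_first[OF this A(1)[OF S(1)] A(2)[OF S(1)] empty_subsetI] that
        show thesis by blast
      qed
      have "fst (\<phi> e) = A S e" if "e \<in> ?H" for e using \<phi>(2) that T by blast
      then have "V = {e \<in> ?H. fst (\<phi> e) = 1}" using S(2) by (auto simp: U_def)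
      then show "V \<in> (\<lambda>\<phi>. {e \<in> ?H. fst (\<phi> e) = 1}) ` ?F" using \<phi>(1) by blast
    qed
    then have cardI: "card I \<le> N" unfolding N_def using finite_nz_flows by (rule surj_card_le[rotated])
    \<comment> \<open>All \<open>S\<close> with support \<open>V\<close> are
      \<open>?M\<close>-subsets of \<open>V\<close>, and \<open>V\<close> has at most
      \<open>?M + J\<close> elements.\<close>
    have fibre: "real (card {S \<in> D. U S = V}) \<le> ?K" if "V \<in> I" for V
    proof -
      obtain S where S: "S \<in> D" "V = U S" using \<open>V \<in> I\<close> by (auto simp: I_def)
      have fin: "finite S" "finite (Q S)" "finite V"
        using S finH by (auto simp: D_def Q_def U_def intro: finite_subset)
      have "S \<inter> Q S = {}" by (auto simp: Q_def)
      then have cV: "card V = ?M + card (Q S)"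
        using S fin UQ by (simp add: card_Un_disjoint D_def)
      have "{S \<in> D. U S = V} \<subseteq> {B. B \<subseteq> V \<and> card B = ?M}" using UQ by (auto simp: D_def)
      then have "card {S \<in> D. U S = V} \<le> card {B. B \<subseteq> V \<and> card B = ?M}"
        using fin by (intro card_mono) auto
      also have "\<dots> = (?M + card (Q S)) choose ?M" using fin cV by (simp add: n_subsets)
      also have "\<dots> = (?M + card (Q S)) choose card (Q S)" by (subst binomial_symmetric) auto
      finally have "real (card {S \<in> D. U S = V}) \<le> 3 ^ card (Q S) * (3 / 2) ^ ?M"
        using binomial_le_3_power[of ?M "card (Q S)"] by linarith
      also have "\<dots> \<le> ?K" using False S(1)
        by (intro mult_right_mono power_increasing) (auto simp: not_less)
      finally show ?thesis .
    qed
    have "D = (\<Union>V\<in>I. {S \<in> D. U S = V})" by (auto simp: I_def)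
    then have "card D \<le> (\<Sum>V\<in>I. card {S \<in> D. U S = V})"
      using card_UN_le[of I "\<lambda>V. {S \<in> D. U S = V}"] finD by (simp add: I_def)
    moreover have "2 ^ ?M \<le> card D" unfolding D_def by (rule card_tree_pairs_ge[OF r T per])
    ultimately have "real (2 ^ ?M) \<le> real (\<Sum>V\<in>I. card {S \<in> D. U S = V})" by linarith
    also have "\<dots> \<le> (\<Sum>V\<in>I. ?K)" unfolding of_nat_sum by (intro sum_mono fibre)
    also have "\<dots> \<le> real N * ?K" using cardI by (simp add: mult_right_mono)
    finally show ?thesis by simp
  qed
qed

end

section \<open>The bounds in terms of \<open>n\<close> and \<open>m\<close>\<close>

text \<open>A single vertex without edges is excepted in (a): its only flow is the empty one, and
  \<open>2 powr (1 / 250) > 1\<close>. The exponent in (b) is an integer, so that the subtraction is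
  not truncated.\<close>

theorem theorem17:
  fixes G :: "('v, 'e) multigraph" and n m :: nat
  assumes "finite_multigraph G"
    and "card (mverts G) = n"
    and "card (medges G) = m"
    and "\<exists>T1 T2. mspanning_tree G T1 \<and> mspanning_tree G T2 \<and> T1 \<inter> T2 = {}"
  shows "(\<not> (n = 1 \<and> m = 0) \<longrightarrow>
           real (card (nowhere_zero_mflows G :: ('e \<Rightarrow> bit \<times> bit) set)) \<ge> 2 powr (real n / 250)) \<and>
         real (card (nowhere_zero_mflows G :: ('e \<Rightarrow> bit \<times> bit) set))
           \<ge> 3 powi (int m - 2 * int n + 2)"
proof -
  interpret finite_multigraph G by fact
  let ?N = "card (nowhere_zero_mflows G :: ('e \<Rightarrow> bit \<times> bit) set)"
  obtain S1 S2 where S: "mspanning_tree G S1" "mspanning_tree G S2" "S1 \<inter> S2 = {}"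
    using assms(4) by blast
  then obtain r where r: "r \<in> mverts G" by (auto simp: mspanning_tree_def mtree_def mconnected_def)
  let ?W = "mverts G - {r}"
  \<comment> \<open>The exchange argument needs odd permanents, so the trees are replaced by subsets
    with that property, which again have \<open>n - 1\<close> edges.\<close>
  obtain T1 where T1: "T1 \<subseteq> S1" "mpermanent G ?W T1 = 1"
    using connecting_obtains_tree[OF _ r] S(1) by (auto simp: mspanning_tree_def mtree_def)
  obtain T2 where T2: "T2 \<subseteq> S2" "mpermanent G ?W T2 = 1"
    using connecting_obtains_tree[OF _ r] S(2) by (auto simp: mspanning_tree_def mtree_def)
  have T: "T1 \<subseteq> medges G" "T2 \<subseteq> medges G" "T1 \<inter> T2 = {}"
    using S T1(1) T2(1) by (auto simp: mspanning_tree_def)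
  have per: "mpermanent G ?W T1 \<noteq> 0" "mpermanent G ?W T2 \<noteq> 0" using T1 T2 by auto
  have conn: "mconnecting G T1" "mconnecting G T2" using T per r by (auto intro: connecting_if_mpermanent_nonzero)
  have n: "n = Suc (card ?W)" using r finite_mverts assms(2) by (metis card_Suc_Diff1)
  have cT: "card T1 = n - 1" "card T2 = n - 1" using mpermanent_nonzero_card per n by fastforce+
  have cH: "card (T1 \<union> T2) = 2 * (n - 1)"
    using T cT finite_sub by (simp add: card_Un_disjoint)
  have "card (T1 \<union> T2) \<le> m" using T finite_medges assms(3) by (metis card_mono Un_least)
  then have cR: "int (card (medges G - (T1 \<union> T2))) = int m - 2 * int n + 2"
    using T finite_sub cH n assms(3) by (subst card_Diff_subset) auto
  have "3 ^ card (medges G - (T1 \<union> T2)) \<le> ?N" using T conn by (intro card_nz_flows_ge_power3)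
  then have b: "3 powi (int m - 2 * int n + 2) \<le> real ?N"
    unfolding cR[symmetric] power_int_of_nat by (simp flip: of_nat_le_iff)
  have a: "2 powr (real n / 250) \<le> real ?N" if "\<not> (n = 1 \<and> m = 0)"
  proof (cases "n = 1")
    case True
    \<comment> \<open>All edges are loops at the single vertex, and (b) already gives
      \<open>3 ^ m\<close> flows.\<close>
    then have "m \<ge> 1" using that by simp
    have "2 powr (real n / 250) \<le> 2 powr 1" using True by (intro powr_mono) auto
    also have "\<dots> \<le> 3 ^ m" using \<open>m \<ge> 1\<close> power_increasing[of 1 m "3::real"] by simp
    also have "\<dots> \<le> real ?N" using b True by (simp add: power_int_of_nat)
    finally show ?thesis .
  next
    case False
    define M where "M = n - 1"
    have M: "n = Suc M" "M \<ge> 1" using False n by (auto simp: M_def)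
    \<comment> \<open>With this \<open>J\<close>, the first alternative suffices, as
      \<open>n = M + 1 \<le> 250 * (J + 1)\<close>.\<close>
    define J where "J = M div 250"
    have J: "250 * J \<le> M" "n \<le> 250 * Suc J" using M by (auto simp: J_def)
    consider "2 ^ Suc J \<le> ?N" | "2 ^ M \<le> real ?N * (3 ^ J * (3 / 2) ^ M)"
      using card_nz_flows_dichotomy[OF r T per, of J] cT by (auto simp: M_def)
    then show ?thesis
    proof cases
      case 1
      have "2 powr (real n / 250) \<le> 2 powr (real (Suc J))" using J(2) by (intro powr_mono) auto
      also have "\<dots> = real (2 ^ Suc J)" by (subst powr_realpow) auto
      also have "\<dots> \<le> real ?N" using 1 by (rule of_nat_mono)
      finally show ?thesis .
    next
      case 2
      \<comment> \<open>The aim is the bound \<open>(4 / 3) ^ M\<close>, because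
        \<open>(4 / 3) * (3 / 2) = 2\<close> turns it into \<open>2 ^ M\<close>.\<close>
      have "2 powr (real n / 250) * 3 ^ J \<le> 2 powr (real M / 125) * 3 powr (real M / 250)"
      proof (intro mult_mono)
        \<comment> \<open>\<open>n = M + 1 \<le> 2 * M\<close>, since
          \<open>M \<ge> 1\<close>.\<close>
        show "2 powr (real n / 250) \<le> 2 powr (real M / 125)" using M by (intro powr_mono) auto
        have "(3::real) ^ J = 3 powr real J" by (simp add: powr_realpow)
        also have "\<dots> \<le> 3 powr (real M / 250)" using J(1) by (intro powr_mono) auto
        finally show "(3::real) ^ J \<le> 3 powr (real M / 250)" .
      qed auto
      also have "2 powr (real M / 125) = (2 powr 2) powr (real M / 250)"
        by (simp only: powr_powr) simp
      also have "\<dots> * 3 powr (real M / 250) = ((2 powr 2) * 3) powr (real M / 250)"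
        by (simp only: powr_mult)
      \<comment> \<open>\<open>4 * 3 = 12\<close> is below \<open>(4 / 3) ^ 10\<close>, which is
        about 17.8; the resulting exponent \<open>10 * M / 250\<close> is at most
        \<open>M\<close>.\<close>
      also have "\<dots> \<le> ((4 / 3) ^ 10) powr (real M / 250)"
        by (intro powr_mono2) (auto simp: power_divide)
      also have "((4 / 3) ^ 10 :: real) = (4 / 3) powr 10" by (simp add: powr_numeral)
      also have "\<dots> powr (real M / 250) = (4 / 3) powr (10 * (real M / 250))" by (rule powr_powr)
      also have "\<dots> \<le> (4 / 3) powr (real M)" by (intro powr_mono) auto
      also have "\<dots> = (4 / 3) ^ M" by (subst powr_realpow) auto
      finally have *: "2 powr (real n / 250) * 3 ^ J \<le> (4 / 3) ^ M" .
      have "(2 powr (real n / 250) * 3 ^ J) * (3 / 2) ^ M \<le> (4 / 3) ^ M * (3 / 2 :: real) ^ M"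
        using * by (intro mult_right_mono) auto
      also have "\<dots> = 2 ^ M" by (simp flip: power_mult_distrib)
      also have "\<dots> \<le> real ?N * (3 ^ J * (3 / 2) ^ M)" by (rule 2)
      finally have "2 powr (real n / 250) * (3 ^ J * (3 / 2) ^ M) \<le> real ?N * (3 ^ J * (3 / 2) ^ M)"
        by (simp only: mult.assoc)
      then show ?thesis by (rule mult_right_le_imp_le) simp
    qed
  qed
  show ?thesis using a b by blast
qed

end
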